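(* Given any two points $P, Q \in \mathbb{S}^3$, there is a smooth horizontal curve in $\mathbb{S}^3$ joining $P$ and $Q$.
   Context: $\mathbb{S}^3=\{(x_1,x_2,y_1,y_2)\in\mathbb{R}^4 : x_1^2+x_2^2+y_1^2+y_2^2=1\}$. On $\mathbb{S}^3$ consider the tangent vector fields $$X = x_2 \partial_{x_1} - x_1 \partial_{x_2} - y_2 \partial_{y_1} + y_1 \partial_{y_2},\qquad Y = y_2 \partial_{x_1} - y_1 \partial_{x_2} + x_2 \partial_{y_1} - x_1 \partial_{y_2}.$$ The horizontal distribution is $\mathcal{H}=\mathrm{span}\{X,Y\}$. A curve on $\mathbb{S}^3$ is called horizontal if its velocity vector belongs to $\mathcal{H}$ at every point of the curve. *)

theory Defs
  imports "HOL-Analysis.Analysis"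
begin

text \<open>
  A point of \<open>real^4\<close> is \<open>(x\<^sub>1, x\<^sub>2, y\<^sub>1, y\<^sub>2) = (p$1, p$2, p$3, p$4)\<close>,
  and a vector field on the three-sphere is given by its components
  with respect to the coordinate fields of the ambient space.
\<close>

abbreviation S3 :: "(real^4) set"
  where "S3 \<equiv> sphere 0 1"

definition field_X :: "real^4 \<Rightarrow> real^4"
  where "field_X p = vector [p$2, - p$1, - p$4, p$3]"

definition field_Y :: "real^4 \<Rightarrow> real^4"
  where "field_Y p = vector [p$4, - p$3, p$2, - p$1]"

definition horizontal_space :: "real^4 \<Rightarrow> (real^4) set"
  where "horizontal_space p = span {field_X p, field_Y p}"

text \<open>
  Infinitely differentiable on \<open>S\<close>: derivatives of all orders exist; \<open>D n\<close> is the \<open>n\<close>-th one.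
  On a closed interval the derivatives at the end points are one-sided, so that
  smoothness holds up to and including the end points.
\<close>

definition smooth_curve_on :: "real set \<Rightarrow> (real \<Rightarrow> 'a::real_normed_vector) \<Rightarrow> bool"
  where "smooth_curve_on S c \<longleftrightarrow>
    (\<exists>D. (\<forall>t\<in>S. D 0 t = c t) \<and>
         (\<forall>n. \<forall>t\<in>S. (D n has_vector_derivative D (Suc n) t) (at t within S)))"

definition horizontal_curve_on :: "real set \<Rightarrow> (real \<Rightarrow> real^4) \<Rightarrow> bool"
  where "horizontal_curve_on S c \<longleftrightarrow>
    (\<forall>t\<in>S. vector_derivative c (at t within S) \<in> horizontal_space (c t))"

lemma S3_iff: "p \<in> S3 \<longleftrightarrow> (p$1)\<^sup>2 + (p$2)\<^sup>2 + (p$3)\<^sup>2 + (p$4)\<^sup>2 = 1"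
  by (simp add: norm_vec_def L2_set_def sum_4)

lemma field_X_nth: "field_X p $ 1 = p$2" "field_X p $ 2 = - p$1"
    "field_X p $ 3 = - p$4" "field_X p $ 4 = p$3"
  unfolding field_X_def vector_def by simp_all

lemma field_Y_nth: "field_Y p $ 1 = p$4" "field_Y p $ 2 = - p$3"
    "field_Y p $ 3 = p$2" "field_Y p $ 4 = - p$1"
  unfolding field_Y_def vector_def by simp_all

lemma field_tangent: "field_X p \<bullet> p = 0" "field_Y p \<bullet> p = 0"
  by (simp_all add: inner_vec_def sum_4 field_X_nth field_Y_nth)

end

theory Submission
  imports Defs "HOL-Complex_Analysis.Complex_Analysis"
begin

text \<open>
  Put the complex coordinates \<open>x\<^sub>1 + \<i> y\<^sub>1\<close> and \<open>x\<^sub>2 + \<i> y\<^sub>2\<close> on \<open>real^4\<close>, so that multiplication by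
  \<open>\<i>\<close> sends a point \<open>p\<close> of the sphere along the Hopf fibre through it. In these coordinates
  \<open>X (u, v) = (cnj v, - cnj u)\<close> and \<open>Y = \<i> X\<close>. Hence the horizontal space at \<open>p\<close> is the complex line
  \<open>\<complex> X p\<close>, and, as \<open>p\<close> and \<open>X p\<close> form a unitary basis for \<open>p\<close> on the sphere, it is the hermitian
  complement of \<open>p\<close>.

  Write curves in the unitary basis \<open>P\<close>, \<open>X P\<close> at the starting point, as \<open>a(t) P + b(t) X P\<close>. With
  \<open>a = cos s \<cdot> e\<^bsup>\<i>\<phi>\<^esup>\<close> and \<open>b = sin s \<cdot> e\<^bsup>\<i>\<psi>\<^esup>\<close> the curve stays on the sphere, and it is horizontal
  iff \<open>cos\<^sup>2 s \<cdot> \<phi>' + sin\<^sup>2 s \<cdot> \<psi>' = 0\<close>. This is solved by \<open>\<phi>' = \<kappa> sin\<^sup>2 s\<close>, \<open>\<psi>' = - \<kappa> cos\<^sup>2 s\<close> for any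
  constant \<open>\<kappa>\<close>; with the linear angle \<open>s = \<sigma> t\<close> both phases are elementary functions. The point
  reached at time \<open>1\<close> is controlled by three independent parameters: \<open>\<sigma>\<close> fixes the moduli of its two
  coordinates, \<open>\<kappa>\<close> the argument of the first one (because \<open>sin\<^sup>2 s\<close> has positive integral), and the
  constant of integration in \<open>\<psi>\<close> the argument of the second one; the last is free since \<open>b(0) = 0\<close>
  anyway. So every point of the sphere is reached from \<open>P\<close>.

  The coordinates \<open>a\<close> and \<open>b\<close> are restrictions of entire functions to the real line, which makes
  the curve smooth.
\<close>

section \<open>Complex coordinates relative to a point of the sphere\<close>

definition times_i :: "real^4 \<Rightarrow> real^4"
  where "times_i p = vector [- p$3, - p$4, p$1, p$2]"

definition complex_scale :: "complex \<Rightarrow> real^4 \<Rightarrow> real^4"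
  where "complex_scale z p = Re z *\<^sub>R p + Im z *\<^sub>R times_i p"

definition frame_point :: "real^4 \<Rightarrow> complex \<Rightarrow> complex \<Rightarrow> real^4"
  where "frame_point P a b = complex_scale a P + complex_scale b (field_X P)"

lemma times_i_nth: "times_i p $ 1 = - p$3" "times_i p $ 2 = - p$4"
    "times_i p $ 3 = p$1" "times_i p $ 4 = p$2"
  unfolding times_i_def vector_def by simp_all

lemma frame_point_nth:
  "frame_point P a b $ 1 = Re a * P$1 - Im a * P$3 + Re b * P$2 + Im b * P$4"
  "frame_point P a b $ 2 = Re a * P$2 - Im a * P$4 - Re b * P$1 - Im b * P$3"
  "frame_point P a b $ 3 = Re a * P$3 + Im a * P$1 - Re b * P$4 + Im b * P$2"
  "frame_point P a b $ 4 = Re a * P$4 + Im a * P$2 + Re b * P$3 - Im b * P$1"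
  by (simp_all add: frame_point_def complex_scale_def times_i_nth field_X_nth algebra_simps)

lemma frame_point_1_0: "frame_point P 1 0 = P"
  by (simp add: vec_eq_iff forall_4 frame_point_nth)

lemma norm4_square: "(norm p)\<^sup>2 = (p$1)\<^sup>2 + (p$2)\<^sup>2 + (p$3)\<^sup>2 + (p$4)\<^sup>2" for p :: "real^4"
  by (simp add: norm_vec_def L2_set_def sum_4)

text \<open>
  Up to the factor \<open>norm P\<close> the frame is unitary; in real coordinates this is Euler's four-square
  identity.
\<close>

lemma norm_frame_point:
  "(norm (frame_point P a b))\<^sup>2 = ((cmod a)\<^sup>2 + (cmod b)\<^sup>2) * (norm P)\<^sup>2"
  unfolding norm4_square cmod_power2 frame_point_nth by algebra

lemma frame_point_surj:
  assumes "norm P = 1"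
  obtains a b where "Q = frame_point P a b"
proof
  let ?a = "Complex (Q \<bullet> P) (Q \<bullet> times_i P)"
  let ?b = "Complex (Q \<bullet> field_X P) (Q \<bullet> field_Y P)"
  have "(norm P)\<^sup>2 *\<^sub>R Q = frame_point P ?a ?b"
    unfolding norm4_square
    by (simp add: vec_eq_iff forall_4 frame_point_nth inner_vec_def sum_4 times_i_nth
        field_X_nth field_Y_nth) algebra
  then show "Q = frame_point P ?a ?b"
    using assms by simp
qed

text \<open>
  In the frame at \<open>P\<close> the field \<open>X\<close> becomes \<open>(a, b) \<mapsto> (- cnj b, cnj a)\<close> and \<open>Y\<close> is \<open>\<i>\<close> times this, so
  a velocity that is a complex multiple of \<open>(- cnj b, cnj a)\<close> is horizontal.
\<close>

lemma horizontal_frame_point: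
  "frame_point P (- \<gamma> * cnj b) (\<gamma> * cnj a) \<in> horizontal_space (frame_point P a b)"
proof -
  let ?p = "frame_point P a b"
  have "frame_point P (- \<gamma> * cnj b) (\<gamma> * cnj a) = Re \<gamma> *\<^sub>R field_X ?p + Im \<gamma> *\<^sub>R field_Y ?p"
    by (simp add: vec_eq_iff forall_4 frame_point_nth field_X_nth field_Y_nth algebra_simps)
  then show ?thesis
    unfolding horizontal_space_def by (simp add: span_add span_scale span_base)
qed

lemma has_vector_derivative_frame_point:
  assumes "(a has_vector_derivative a') F" and "(b has_vector_derivative b') F"
  shows "((\<lambda>t. frame_point P (a t) (b t)) has_vector_derivative frame_point P a' b') F"
proof -
  have "bounded_linear (\<lambda>z. complex_scale z p)" for p
    unfolding complex_scale_def
    by (intro bounded_linear_add bounded_linear_scaleR_const bounded_linear_Re bounded_linear_Im)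
  note this [THEN bounded_linear.has_vector_derivative]
  then show ?thesis
    unfolding frame_point_def by (intro has_vector_derivative_add) (use assms in blast)+
qed

section \<open>Curves with entire coordinate functions\<close>

lemma has_vector_derivative_of_holomorphic:
  assumes "f holomorphic_on UNIV"
  shows "((\<lambda>t. f (complex_of_real t)) has_vector_derivative deriv f (complex_of_real t)) (at t within S)"
  using assms holomorphic_derivI[of f UNIV "complex_of_real t"]
  by (auto intro: has_vector_derivative_real_field)

lemma smooth_curve_frame_point:
  assumes "a holomorphic_on UNIV" and "b holomorphic_on UNIV"
  shows "smooth_curve_on S (\<lambda>t. frame_point P (a (complex_of_real t)) (b (complex_of_real t)))"
  unfolding smooth_curve_on_def
proof (intro exI conjI ballI allI)
  let ?D = "\<lambda>n t. frame_point P ((deriv ^^ n) a (complex_of_real t)) ((deriv ^^ n) b (complex_of_real t))"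
  show "?D 0 t = frame_point P (a (complex_of_real t)) (b (complex_of_real t))" for t
    by simp
  have hol: "(deriv ^^ n) f holomorphic_on UNIV" if "f holomorphic_on UNIV" for n f
    using that by (intro holomorphic_higher_deriv) auto
  show "(?D n has_vector_derivative ?D (Suc n) t) (at t within S)" for n t
    using has_vector_derivative_frame_point[OF
        has_vector_derivative_of_holomorphic[OF hol[OF assms(1)]]
        has_vector_derivative_of_holomorphic[OF hol[OF assms(2)]]]
    by simp
qed

section \<open>The horizontal curves\<close>

text \<open>The antiderivative of \<open>\<kappa> sin\<^sup>2 (\<sigma> z)\<close> that vanishes at \<open>0\<close>.\<close>

definition phase :: "real \<Rightarrow> real \<Rightarrow> complex \<Rightarrow> complex"
  where "phase \<sigma> \<kappa> z = \<kappa> * (z / 2 - sin (2 * \<sigma> * z) / (4 * \<sigma>))"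

definition coord1 :: "real \<Rightarrow> real \<Rightarrow> complex \<Rightarrow> complex"
  where "coord1 \<sigma> \<kappa> z = cos (\<sigma> * z) * exp (\<i> * phase \<sigma> \<kappa> z)"

text \<open>
  The phase of the second coordinate is \<open>phase \<sigma> \<kappa> z - \<kappa> * z\<close>, whose derivative is
  \<open>- \<kappa> cos\<^sup>2 (\<sigma> z)\<close>; the unimodular constant \<open>\<omega>\<close> accounts for its value at \<open>0\<close>.
\<close>

definition coord2 :: "real \<Rightarrow> real \<Rightarrow> complex \<Rightarrow> complex \<Rightarrow> complex"
  where "coord2 \<sigma> \<kappa> \<omega> z = \<omega> * sin (\<sigma> * z) * exp (\<i> * (phase \<sigma> \<kappa> z - \<kappa> * z))"

definition curve :: "real \<Rightarrow> real \<Rightarrow> complex \<Rightarrow> real^4 \<Rightarrow> real \<Rightarrow> real^4"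
  where "curve \<sigma> \<kappa> \<omega> P t =
    frame_point P (coord1 \<sigma> \<kappa> (complex_of_real t)) (coord2 \<sigma> \<kappa> \<omega> (complex_of_real t))"

lemma phase_of_real:
  "phase \<sigma> \<kappa> (complex_of_real t) = complex_of_real (\<kappa> * (t / 2 - sin (2 * \<sigma> * t) / (4 * \<sigma>)))"
  by (simp add: phase_def flip: sin_of_real)

lemma has_field_derivative_phase [derivative_intros]:
  assumes "\<sigma> \<noteq> 0"
  shows "(phase \<sigma> \<kappa> has_field_derivative \<kappa> * (sin (\<sigma> * z))\<^sup>2) (at z)"
proof -
  have "(phase \<sigma> \<kappa> has_field_derivative \<kappa> * (1 / 2 - cos (2 * (\<sigma> * z)) / 2)) (at z)"
    unfolding phase_def using assms
    by (auto intro!: derivative_eq_intros simp: field_simps)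
  moreover have "1 / 2 - cos (2 * (\<sigma> * z)) / 2 = (sin (\<sigma> * z))\<^sup>2"
    unfolding cos_double_sin by (simp add: field_simps)
  ultimately show ?thesis
    by simp
qed

lemma coord_holomorphic:
  assumes "\<sigma> \<noteq> 0"
  shows "coord1 \<sigma> \<kappa> holomorphic_on UNIV" "coord2 \<sigma> \<kappa> \<omega> holomorphic_on UNIV"
  using assms unfolding coord1_def coord2_def phase_def by (auto intro!: holomorphic_intros)

lemma smooth_curve: "\<sigma> \<noteq> 0 \<Longrightarrow> smooth_curve_on S (curve \<sigma> \<kappa> \<omega> P)"
  unfolding curve_def [abs_def] by (intro smooth_curve_frame_point coord_holomorphic)

lemma curve_in_sphere:
  assumes "P \<in> S3" and "cmod \<omega> = 1"
  shows "curve \<sigma> \<kappa> \<omega> P t \<in> S3"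
proof -
  have a: "cmod (coord1 \<sigma> \<kappa> (complex_of_real t)) = \<bar>cos (\<sigma> * t)\<bar>"
    unfolding coord1_def phase_of_real norm_mult norm_exp_i_times
    by (metis mult.right_neutral norm_of_real cos_of_real of_real_mult)
  have b: "cmod (coord2 \<sigma> \<kappa> \<omega> (complex_of_real t)) = \<bar>sin (\<sigma> * t)\<bar>"
    unfolding coord2_def phase_of_real norm_mult assms(2)
      of_real_mult[symmetric] of_real_diff[symmetric] norm_exp_i_times
    by (metis mult.right_neutral mult_1 norm_of_real sin_of_real of_real_mult)
  have "(norm (curve \<sigma> \<kappa> \<omega> P t))\<^sup>2 = 1"
    unfolding curve_def norm_frame_point a b using assms(1) by simp
  then show ?thesis
    by (metis abs_norm_cancel abs_square_eq_1 mem_sphere_0)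
qed

text \<open>
  The velocity is \<open>\<gamma>\<close> times \<open>(- cnj b, cnj a)\<close>, where
  \<open>\<gamma> = e\<^bsup>\<i>(\<phi>+\<psi>)\<^esup> (\<sigma> - \<i> \<kappa> sin (\<sigma> t) cos (\<sigma> t))\<close>. Both coordinates give the same \<open>\<gamma>\<close> precisely because
  the phases satisfy the horizontality condition.
\<close>

lemma curve_horizontal:
  assumes "\<sigma> \<noteq> 0" and "cmod \<omega> = 1"
  shows "\<exists>v \<in> horizontal_space (curve \<sigma> \<kappa> \<omega> P t).
           (curve \<sigma> \<kappa> \<omega> P has_vector_derivative v) (at t within S)"
proof -
  define z where "z = complex_of_real t"
  define e where "e = exp (\<i> * phase \<sigma> \<kappa> z)"
  define f where "f = exp (\<i> * (phase \<sigma> \<kappa> z - \<kappa> * z))"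
  define \<gamma> where "\<gamma> = \<omega> * e * f * (\<sigma> - \<i> * \<kappa> * sin (\<sigma> * z) * cos (\<sigma> * z))"
  have cnj: "cnj (phase \<sigma> \<kappa> z) = phase \<sigma> \<kappa> z" "cnj z = z"
    unfolding z_def phase_of_real by simp_all
  have [simp]: "cnj (sin (\<sigma> * z)) = sin (\<sigma> * z)" "cnj (cos (\<sigma> * z)) = cos (\<sigma> * z)"
    unfolding z_def of_real_mult[symmetric] sin_of_real cos_of_real by simp_all
  have e: "e * cnj e = 1" and f: "f * cnj f = 1"
    unfolding e_def f_def exp_cnj by (simp_all add: cnj flip: exp_add)
  have w: "\<omega> * cnj \<omega> = 1"
    using assms(2) by (simp add: complex_norm_square[symmetric])
  have 1: "(coord1 \<sigma> \<kappa> has_field_derivative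
      (- \<sigma> * sin (\<sigma> * z) + \<i> * \<kappa> * (sin (\<sigma> * z))\<^sup>2 * cos (\<sigma> * z)) * e) (at z)"
    unfolding coord1_def [abs_def] e_def
    by (rule derivative_eq_intros assms refl | simp add: algebra_simps)+
  have "(coord2 \<sigma> \<kappa> \<omega> has_field_derivative
      \<omega> * (\<sigma> * cos (\<sigma> * z) + \<i> * (\<kappa> * (sin (\<sigma> * z))\<^sup>2 - \<kappa>) * sin (\<sigma> * z)) * f) (at z)"
    unfolding coord2_def [abs_def] f_def
    by (rule derivative_eq_intros assms refl | simp add: algebra_simps)+
  then have 2: "(coord2 \<sigma> \<kappa> \<omega> has_field_derivative
      \<omega> * (\<sigma> * cos (\<sigma> * z) - \<i> * \<kappa> * (cos (\<sigma> * z))\<^sup>2 * sin (\<sigma> * z)) * f) (at z)"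
    unfolding sin_squared_eq by (simp add: algebra_simps)
  have "(- \<sigma> * sin (\<sigma> * z) + \<i> * \<kappa> * (sin (\<sigma> * z))\<^sup>2 * cos (\<sigma> * z)) * e
      = - \<gamma> * cnj (coord2 \<sigma> \<kappa> \<omega> z)"
    unfolding \<gamma>_def coord2_def f_def[symmetric] complex_cnj_mult using f w
    by simp algebra
  moreover have "\<omega> * (\<sigma> * cos (\<sigma> * z) - \<i> * \<kappa> * (cos (\<sigma> * z))\<^sup>2 * sin (\<sigma> * z)) * f
      = \<gamma> * cnj (coord1 \<sigma> \<kappa> z)"
    unfolding \<gamma>_def coord1_def e_def[symmetric] complex_cnj_mult using e
    by simp algebra
  ultimately have "(curve \<sigma> \<kappa> \<omega> P has_vector_derivative
      frame_point P (- \<gamma> * cnj (coord2 \<sigma> \<kappa> \<omega> z)) (\<gamma> * cnj (coord1 \<sigma> \<kappa> z))) (at t within S)"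
    unfolding curve_def [abs_def] using 1 2
    by (intro has_vector_derivative_frame_point has_vector_derivative_real_field)
      (simp_all add: z_def)
  then show ?thesis
    using horizontal_frame_point unfolding curve_def z_def by blast
qed

lemma curve_start: "curve \<sigma> \<kappa> \<omega> P 0 = P"
  by (simp add: curve_def coord1_def coord2_def phase_def frame_point_1_0)

text \<open>
  The parameters are found one after the other: \<open>\<sigma>\<close> from the moduli of the coordinates of \<open>Q\<close>, then
  \<open>\<kappa>\<close> from the argument of the first and \<open>\<omega>\<close> from the argument of the second coordinate.
\<close>

lemma curve_reaches:
  assumes "P \<in> S3" and "Q \<in> S3"
  obtains \<sigma> \<kappa> \<omega> where "\<sigma> \<noteq> 0" "cmod \<omega> = 1" "curve \<sigma> \<kappa> \<omega> P 1 = Q"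
proof -
  obtain a b where Q: "Q = frame_point P a b"
    using frame_point_surj assms(1) by (metis mem_sphere_0)
  have "(cmod a)\<^sup>2 + (cmod b)\<^sup>2 = 1"
    using norm_frame_point[of P a b] assms Q by simp
  then obtain s where s: "0 \<le> s" "cmod a = cos s" "cmod b = sin s"
    using sincos_total_pi_half[of "cmod a" "cmod b"] by auto
  \<comment> \<open>The full turn keeps \<open>\<sigma>\<close> away from \<open>0\<close> when \<open>b = 0\<close>: even if \<open>Q\<close> lies on the Hopf fibre of
    \<open>P\<close>, the curve must leave that fibre in order to change the phase.\<close>
  define \<sigma> where "\<sigma> = s + 2 * pi"
  have \<sigma>: "\<sigma> > 1" "cos \<sigma> = cmod a" "sin \<sigma> = cmod b"
    using s pi_gt3 by (simp_all add: \<sigma>_def)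
  \<comment> \<open>\<open>m\<close> is the integral of \<open>sin\<^sup>2 (\<sigma> t)\<close> over the unit interval.\<close>
  define m where "m = 1 / 2 - sin (2 * \<sigma>) / (4 * \<sigma>)"
  have "m > 0"
  proof -
    have "sin (2 * \<sigma>) < 2 * \<sigma>"
      using \<sigma>(1) sin_le_one[of "2 * \<sigma>"] by linarith
    then show ?thesis
      using \<sigma>(1) by (simp add: m_def divide_simps)
  qed
  define \<kappa> where "\<kappa> = Arg a / m"
  define \<omega> where "\<omega> = exp (\<i> * complex_of_real (Arg b - Arg a + \<kappa>))"
  have ph: "phase \<sigma> \<kappa> 1 = Arg a"
    using phase_of_real[of \<sigma> \<kappa> 1] \<open>m > 0\<close> by (simp add: \<kappa>_def flip: m_def)
  have polar: "complex_of_real (cmod z) * exp (\<i> * Arg z) = z" for z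
    using rcis_cmod_Arg[of z] by (simp add: rcis_def cis_conv_exp)
  have "coord1 \<sigma> \<kappa> 1 = a"
    using polar[of a] by (simp add: coord1_def ph \<sigma> cos_of_real)
  moreover have "coord2 \<sigma> \<kappa> \<omega> 1 = b"
  proof -
    have "coord2 \<sigma> \<kappa> \<omega> 1 = cmod b * (\<omega> * exp (\<i> * (Arg a - \<kappa>)))"
      by (simp add: coord2_def ph \<sigma> sin_of_real)
    also have "\<omega> * exp (\<i> * (Arg a - \<kappa>)) = exp (\<i> * Arg b)"
      unfolding \<omega>_def by (simp add: algebra_simps flip: exp_add)
    finally show ?thesis
      using polar by simp
  qed
  ultimately have "curve \<sigma> \<kappa> \<omega> P 1 = Q"
    by (simp add: curve_def Q)
  moreover have "cmod \<omega> = 1"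
    unfolding \<omega>_def by (rule norm_exp_i_times)
  ultimately show ?thesis
    using that[of \<sigma> \<omega> \<kappa>] \<sigma>(1) by simp
qed

theorem theorem4p4:
  fixes P Q :: "real^4"
  assumes "P \<in> S3" and "Q \<in> S3"
  shows "\<exists>c :: real \<Rightarrow> real^4.
           smooth_curve_on {0..1} c \<and> path_image c \<subseteq> S3 \<and> horizontal_curve_on {0..1} c \<and>
           pathstart c = P \<and> pathfinish c = Q"
proof -
  obtain \<sigma> \<kappa> \<omega> where par: "\<sigma> \<noteq> 0" "cmod \<omega> = 1" and Q: "curve \<sigma> \<kappa> \<omega> P 1 = Q"
    using curve_reaches[OF assms] .
  let ?c = "curve \<sigma> \<kappa> \<omega> P"
  have "horizontal_curve_on {0..1} ?c"
    unfolding horizontal_curve_on_def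
  proof
    fix t :: real
    assume t: "t \<in> {0..1}"
    obtain v where v: "v \<in> horizontal_space (?c t)"
        "(?c has_vector_derivative v) (at t within {0..1})"
      using curve_horizontal[OF par] by blast
    have "vector_derivative ?c (at t within {0..1}) = v"
      using vector_derivative_within_cbox[of 0 1] v(2) t by simp
    with v(1) show "vector_derivative ?c (at t within {0..1}) \<in> horizontal_space (?c t)"
      by simp
  qed
  moreover have "path_image ?c \<subseteq> S3"
    using curve_in_sphere[OF assms(1) par(2)] by (auto simp: path_image_def)
  ultimately show ?thesis
    using smooth_curve[OF par(1)] Q
    by (intro exI[of _ ?c]) (simp add: pathstart_def pathfinish_def curve_start)
qed

end
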